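(* Consider $\mathrm{SO}(2)$-steerable kernels $K:S^1\to\mathrm{Hom}_{\mathbb R}(V_l,V_J)$, where $V_l$ and $V_J$ ($l,J\in\mathbb N_{\ge0}$) are irreducible real representations of $\mathrm{SO}(2)$. Written as matrices with respect to the standard bases: 1. For $l=J=0$, $K(x)=a\cdot(1)$ for every $x\in S^1$, with an arbitrary real number $a\in\mathbb R$ independent of $x$. 2. For $l=0$, $J>0$, a basis of the space of steerable kernels is given by $\begin{pmatrix}\cos_J\\ \sin_J\end{pmatrix}$ and $\begin{pmatrix}-\sin_J\\ \cos_J\end{pmatrix}$. 3. For $l>0$, $J=0$, a basis of the space of steerable kernels is given by $\begin{pmatrix}\cos_l&\sin_l\end{pmatrix}$ and $\begin{pmatrix}\sin_l&-\cos_l\end{pmatrix}$. 4. For $l,J>0$, a basis of the space of steerable kernels is given by $$\begin{pmatrix}\cos_{J-l}&-\sin_{J-l}\\ \sin_{J-l}&\cos_{J-l}\end{pmatrix},\quad \begin{pmatrix}-\sin_{J-l}&-\cos_{J-l}\\ \cos_{J-l}&-\sin_{J-l}\end{pmatrix},\quad \begin{pmatrix}\cos_{J+l}&\sin_{J+l}\\ \sin_{J+l}&-\cos_{J+l}\end{pmatrix},\quad \begin{pmatrix}-\sin_{J+l}&\cos_{J+l}\\ \cos_{J+l}&\sin_{J+l}\end{pmatrix}.$$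
   Context: Identify $\mathrm{SO}(2)=\mathbb R/2\pi\mathbb Z$ (angles) and $S^1=\mathbb R/2\pi\mathbb Z$, with action $\phi\cdot x=\phi+x$. The irreducible real (orthogonal) representations are $\rho_l:\mathrm{SO}(2)\to\mathrm O(V_l)$, $l\in\mathbb N_{\ge0}$: $V_0=\mathbb R$ with trivial action, and for $l\ge1$, $V_l=\mathbb R^2$ with $\rho_l(\phi)=\begin{pmatrix}\cos(l\phi)&-\sin(l\phi)\\ \sin(l\phi)&\cos(l\phi)\end{pmatrix}$. A steerable kernel is any function $K:S^1\to\mathrm{Hom}_{\mathbb R}(V_l,V_J)$ with $K(\phi\cdot x)=\rho_J(\phi)\circ K(x)\circ\rho_l(\phi)^{-1}$ for all $\phi\in\mathrm{SO}(2),x\in S^1$. For $k\in\mathbb Z$, $\cos_k(x)=\cos(kx)$ and $\sin_k(x)=\sin(kx)$; a matrix of such functions denotes the kernel $x\mapsto$ (matrix of values at $x$). *)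

theory Defs
  imports Complex_Main "HOL-Library.Real_Mod" "Jordan_Normal_Form.VS_Connect"
begin

text \<open>
  The group \<open>SO(2)\<close> and the circle \<open>S\<^sup>1\<close> are both \<open>\<real> / 2\<pi>\<int>\<close>; the action of \<open>SO(2)\<close> on
  \<open>S\<^sup>1\<close> is the addition of this group.
\<close>

quotient_type angle = real / "\<lambda>x y. [x = y] (rmod (2 * pi))"
  by (rule equivpI) (auto intro!: reflpI sympI transpI intro: rcong_sym rcong_trans)

instantiation angle :: ab_group_add
begin

lift_definition zero_angle :: angle is 0 .

lift_definition plus_angle :: "angle \<Rightarrow> angle \<Rightarrow> angle" is "(+)"
  by (rule rcong_add)

lift_definition uminus_angle :: "angle \<Rightarrow> angle" is uminus
  by (rule rcong_uminus)

lift_definition minus_angle :: "angle \<Rightarrow> angle \<Rightarrow> angle" is "(-)"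
  by (rule rcong_diff)

instance
  by standard (transfer, simp add: algebra_simps)+

end

lemma rcong_2pi_cases:
  assumes "[x = y] (rmod (2 * pi))"
  obtains k :: int where "x = y + 2 * pi * of_int k"
proof -
  have "x = y + 2 * pi * of_int (\<lfloor>x / (2 * pi)\<rfloor> - \<lfloor>y / (2 * pi)\<rfloor>)"
    using assms by (simp add: rcong_def rmod_def algebra_simps split: if_splits)
  then show ?thesis
    by (rule that)
qed

lift_definition cos_k :: "int \<Rightarrow> angle \<Rightarrow> real" is "\<lambda>k x. cos (of_int k * x)"
proof (elim rcong_2pi_cases)
  fix k m :: int and x y :: real
  assume "x = y + 2 * pi * of_int m"
  then have "of_int k * x = of_int k * y + (2 * pi) * of_int (k * m)"
    by (simp add: algebra_simps)
  then show "cos (of_int k * x) = cos (of_int k * y)"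
    by (simp only: cos_add cos_int_2pin sin_int_2pin mult_1_right mult_zero_right add_0_right diff_zero)
qed

lift_definition sin_k :: "int \<Rightarrow> angle \<Rightarrow> real" is "\<lambda>k x. sin (of_int k * x)"
proof (elim rcong_2pi_cases)
  fix k m :: int and x y :: real
  assume "x = y + 2 * pi * of_int m"
  then have "of_int k * x = of_int k * y + (2 * pi) * of_int (k * m)"
    by (simp add: algebra_simps)
  then show "sin (of_int k * x) = sin (of_int k * y)"
    by (simp only: sin_add cos_int_2pin sin_int_2pin mult_1_right mult_zero_right add_0_right diff_zero)
qed

lemma cos_k_0 [simp]: "cos_k k 0 = 1" and sin_k_0 [simp]: "sin_k k 0 = 0"
  by (transfer, simp)+

lemma cos_k_add: "cos_k k (x + y) = cos_k k x * cos_k k y - sin_k k x * sin_k k y"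
  by transfer (simp add: cos_add algebra_simps)

lemma sin_k_add: "sin_k k (x + y) = sin_k k x * cos_k k y + cos_k k x * sin_k k y"
  by transfer (simp add: sin_add algebra_simps)

text \<open>
  \<open>V\<^sub>l\<close> is the space of real column vectors of length \<open>irrep_dim l\<close>. A linear map between two such
  spaces is identified with its matrix with respect to the standard bases.
\<close>

definition irrep_dim :: "nat \<Rightarrow> nat" where
  "irrep_dim l = (if l = 0 then 1 else 2)"

definition irrep :: "nat \<Rightarrow> angle \<Rightarrow> real mat" where
  "irrep l \<phi> =
     (if l = 0 then 1\<^sub>m 1
      else mat_of_rows_list 2
        [[cos_k (int l) \<phi>, - sin_k (int l) \<phi>],
         [sin_k (int l) \<phi>,   cos_k (int l) \<phi>]])"

lemma irrep_carrier [simp]: "irrep l \<phi> \<in> carrier_mat (irrep_dim l) (irrep_dim l)"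
  by (simp add: irrep_def irrep_dim_def mat_of_rows_list_def numeral_2_eq_2)

lemma irrep_0: "irrep l 0 = 1\<^sub>m (irrep_dim l)"
  by (rule eq_matI)
    (auto simp: irrep_def irrep_dim_def mat_of_rows_list_def less_Suc_eq numeral_2_eq_2)

lemma irrep_add: "irrep l (\<phi> + \<psi>) = irrep l \<phi> * irrep l \<psi>"
  by (rule eq_matI)
    (auto simp: irrep_def irrep_dim_def mat_of_rows_list_def less_Suc_eq numeral_2_eq_2
      scalar_prod_def cos_k_add sin_k_add)

lemma irrep_Units: "irrep l \<phi> \<in> Units (ring_mat TYPE(real) (irrep_dim l) ())"
  using irrep_add[of l \<phi> "- \<phi>"] irrep_add[of l "- \<phi>" \<phi>]
  by (auto simp: Units_def ring_mat_simps irrep_0 intro!: bexI[of _ "irrep l (- \<phi>)"])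

definition irrep_inv :: "nat \<Rightarrow> angle \<Rightarrow> real mat" where
  "irrep_inv l \<phi> = inv\<^bsub>ring_mat TYPE(real) (irrep_dim l) ()\<^esub> (irrep l \<phi>)"

lemma irrep_inv_carrier [simp]: "irrep_inv l \<phi> \<in> carrier_mat (irrep_dim l) (irrep_dim l)"
proof -
  interpret ring "ring_mat TYPE(real) (irrep_dim l) ()"
    by (rule ring_mat)
  show ?thesis
    using Units_inv_closed[OF irrep_Units] by (simp add: irrep_inv_def ring_mat_simps)
qed

definition steerable :: "nat \<Rightarrow> nat \<Rightarrow> (angle \<Rightarrow> real mat) \<Rightarrow> bool" where
  "steerable l J K \<longleftrightarrow>
     (\<forall>x. K x \<in> carrier_mat (irrep_dim J) (irrep_dim l)) \<and>
     (\<forall>\<phi> x. K (\<phi> + x) = irrep J \<phi> * K x * irrep_inv l \<phi>)"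

text \<open>The fields \<^term>\<open>mult\<close> and \<^term>\<open>one\<close> of a module record play no role in a vector space.\<close>

definition kernel_space :: "nat \<Rightarrow> nat \<Rightarrow> (real, angle \<Rightarrow> real mat) module" where
  "kernel_space l J =
     \<lparr>carrier = {K. steerable l J K},
      mult = undefined,
      one = undefined,
      zero = (\<lambda>x. 0\<^sub>m (irrep_dim J) (irrep_dim l)),
      add = (\<lambda>K L x. K x + L x),
      smult = (\<lambda>a K x. a \<cdot>\<^sub>m K x)\<rparr>"

lemma steerable_zero: "steerable l J (\<lambda>x. 0\<^sub>m (irrep_dim J) (irrep_dim l))"
  by (simp add: steerable_def right_mult_zero_mat[OF irrep_carrier]
      left_mult_zero_mat[OF irrep_inv_carrier])

lemma steerable_add:
  assumes "steerable l J K" "steerable l J L"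
  shows "steerable l J (\<lambda>x. K x + L x)"
proof -
  have K: "K x \<in> carrier_mat (irrep_dim J) (irrep_dim l)"
    and L: "L x \<in> carrier_mat (irrep_dim J) (irrep_dim l)" for x
    using assms by (auto simp: steerable_def)
  have "irrep J \<phi> * (K x + L x) * irrep_inv l \<phi> =
      irrep J \<phi> * K x * irrep_inv l \<phi> + irrep J \<phi> * L x * irrep_inv l \<phi>" for \<phi> x
    using mult_add_distrib_mat[OF irrep_carrier K L]
      add_mult_distrib_mat[OF mult_carrier_mat[OF irrep_carrier K]
        mult_carrier_mat[OF irrep_carrier L] irrep_inv_carrier]
    by simp
  with assms K L show ?thesis
    by (simp add: steerable_def)
qed

lemma steerable_smult:
  assumes "steerable l J K"
  shows "steerable l J (\<lambda>x. a \<cdot>\<^sub>m K x)"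
proof -
  have K: "K x \<in> carrier_mat (irrep_dim J) (irrep_dim l)" for x
    using assms by (auto simp: steerable_def)
  have "irrep J \<phi> * (a \<cdot>\<^sub>m K x) * irrep_inv l \<phi> = a \<cdot>\<^sub>m (irrep J \<phi> * K x * irrep_inv l \<phi>)"
    for \<phi> x
    using mult_smult_distrib[OF irrep_carrier K]
      mult_smult_assoc_mat[OF mult_carrier_mat[OF irrep_carrier K] irrep_inv_carrier]
    by simp
  with assms K show ?thesis
    by (simp add: steerable_def)
qed

lemma kernel_space_vectorspace: "vectorspace class_ring (kernel_space l J)"
proof -
  let ?V = "kernel_space l J"
  have carrier: "K x \<in> carrier_mat (irrep_dim J) (irrep_dim l)" if "steerable l J K" for K x
    using that by (simp add: steerable_def)
  have abelian: "abelian_group ?V"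
  proof (rule abelian_groupI)
    fix K assume K: "K \<in> carrier ?V"
    then have "steerable l J (\<lambda>x. (-1) \<cdot>\<^sub>m K x)"
      by (simp add: kernel_space_def steerable_smult)
    moreover have "(-1) \<cdot>\<^sub>m K x + K x = 0\<^sub>m (irrep_dim J) (irrep_dim l)" for x
      using K carrier[of K x] by (auto simp: kernel_space_def)
    ultimately show "\<exists>L \<in> carrier ?V. L \<oplus>\<^bsub>?V\<^esub> K = \<zero>\<^bsub>?V\<^esub>"
      by (auto simp: kernel_space_def intro!: exI[of _ "\<lambda>x. (-1) \<cdot>\<^sub>m K x"])
  qed (auto simp: kernel_space_def steerable_zero steerable_add fun_eq_iff
      intro: assoc_add_mat comm_add_mat left_add_zero_mat carrier)
  have "Module.module class_ring ?V"
  proof (rule moduleI)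
    show "cring (class_ring :: real ring)"
      by (rule class_cring.is_cring)
  qed (use abelian in \<open>auto simp: kernel_space_def steerable_smult fun_eq_iff
      intro: add_smult_distrib_right_mat add_smult_distrib_left_mat dest: carrier\<close>)
  then show ?thesis
    by (intro vectorspace.intro class_field)
qed

text \<open>A list enumerates a basis if it is free of repetitions and its set of entries is a basis.\<close>

definition kernel_basis :: "nat \<Rightarrow> nat \<Rightarrow> (angle \<Rightarrow> real mat) list \<Rightarrow> bool" where
  "kernel_basis l J Ks \<longleftrightarrow>
     distinct Ks \<and> vectorspace.basis class_ring (kernel_space l J) (set Ks)"

text \<open>A matrix of functions denotes the kernel of its values.\<close>

definition kernel_of :: "(angle \<Rightarrow> real) mat \<Rightarrow> angle \<Rightarrow> real mat" where
  "kernel_of M x = map_mat (\<lambda>f. f x) M"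

end

(* A steerable kernel on the circle is determined by its value at the angle 0, because the action is
   transitive, and every matrix occurs as such a value, because the action is free: a matrix M extends
   to the kernel x |-> rho_J(x) M rho_l(x)^(-1). Hence evaluation at 0 is an isomorphism onto the
   space of matrices, and the listed kernels form a basis as soon as their values at 0 do. *)
theory Submission
  imports Defs
begin

section \<open>Trigonometric identities in the angle and in the frequency\<close>

lemma cos_k_uminus [simp]: "cos_k k (- x) = cos_k k x"
  by transfer simp

lemma sin_k_uminus [simp]: "sin_k k (- x) = - sin_k k x"
  by transfer simp

text \<open>Here the frequency varies and the angle is fixed. These rules expand entries of
  frequency J + l or J - l into the products that arise from \<open>irrep J x\<close> and
  \<open>irrep l (- x)\<close>.\<close>

lemma cos_k_add_index: "cos_k (k + m) x = cos_k k x * cos_k m x - sin_k k x * sin_k m x"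
  by transfer (simp add: distrib_right cos_add)

lemma sin_k_add_index: "sin_k (k + m) x = sin_k k x * cos_k m x + cos_k k x * sin_k m x"
  by transfer (simp add: distrib_right sin_add)

lemma cos_k_diff_index: "cos_k (k - m) x = cos_k k x * cos_k m x + sin_k k x * sin_k m x"
  by transfer (simp add: left_diff_distrib cos_diff)

lemma sin_k_diff_index: "sin_k (k - m) x = sin_k k x * cos_k m x - cos_k k x * sin_k m x"
  by transfer (simp add: left_diff_distrib sin_diff)

section \<open>Steerable kernels and their values at 0\<close>

text \<open>By the homomorphism property \<open>irrep l (- \<phi>)\<close> is a two-sided inverse,
  and inverses are unique.\<close>

lemma irrep_inv_eq: "irrep_inv l \<phi> = irrep l (- \<phi>)"
proof -
  interpret ring "ring_mat TYPE(real) (irrep_dim l) ()"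
    by (rule ring_mat)
  show ?thesis
    unfolding irrep_inv_def
    by (rule inv_unique'[symmetric])
      (simp_all add: ring_mat_simps irrep_add[symmetric] irrep_0)
qed

text \<open>This is equivariance at the base point 0, moved to x = x + 0 by the group element x
  itself.\<close>

lemma steerable_eq_value_at_0:
  assumes "steerable l J K"
  shows "K x = irrep J x * K 0 * irrep l (- x)"
  using assms unfolding steerable_def irrep_inv_eq by (metis add.right_neutral)

lemma steerable_iff_value_at_0:
  "steerable l J K \<longleftrightarrow>
     (\<exists>M \<in> carrier_mat (irrep_dim J) (irrep_dim l). \<forall>x. K x = irrep J x * M * irrep l (- x))"
    (is "_ \<longleftrightarrow> ?rhs")
proof
  assume "steerable l J K"
  then show ?rhs
    using steerable_eq_value_at_0 by (auto simp: steerable_def intro!: bexI[of _ "K 0"])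
next
  assume ?rhs
  then obtain M where M: "M \<in> carrier_mat (irrep_dim J) (irrep_dim l)"
    and K: "\<And>x. K x = irrep J x * M * irrep l (- x)"
    by blast
  have "irrep J (\<phi> + x) * M * irrep l (- (\<phi> + x)) =
      irrep J \<phi> * (irrep J x * M * irrep l (- x)) * irrep l (- \<phi>)" for \<phi> x
  proof -
    \<comment> \<open>In this order the inverse action of \<open>\<phi>\<close> becomes the
      outermost factor on the right.\<close>
    have "- (\<phi> + x) = - x + - \<phi>"
      by simp
    then have "irrep J (\<phi> + x) * M * irrep l (- (\<phi> + x)) =
        irrep J \<phi> * irrep J x * M * (irrep l (- x) * irrep l (- \<phi>))"
      by (simp only: irrep_add)
    also have "\<dots> = irrep J \<phi> * (irrep J x * M * irrep l (- x)) * irrep l (- \<phi>)"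
      using M irrep_carrier[of J \<phi>] irrep_carrier[of J x] irrep_carrier[of l "- x"]
        irrep_carrier[of l "- \<phi>"]
      by (smt (verit) assoc_mult_mat mult_carrier_mat)
    finally show ?thesis .
  qed
  then show "steerable l J K"
    using mult_carrier_mat[OF mult_carrier_mat[OF irrep_carrier M] irrep_carrier]
    by (simp add: steerable_def irrep_inv_eq K)
qed

text \<open>Equivariance in two angles is reduced to a matrix identity in the single angle x, which
  can be checked entry by entry.\<close>

lemma steerable_kernel_of:
  assumes "M \<in> carrier_mat (irrep_dim J) (irrep_dim l)"
    and "\<And>x. kernel_of M x = irrep J x * kernel_of M 0 * irrep l (- x)"
  shows "steerable l J (kernel_of M)"
  unfolding steerable_iff_value_at_0
proof (intro bexI[of _ "kernel_of M 0"] allI)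
  show "kernel_of M 0 \<in> carrier_mat (irrep_dim J) (irrep_dim l)"
    using assms(1) by (simp add: kernel_of_def)
qed (rule assms(2))

text \<open>Injectivity of evaluation at 0.\<close>

lemma steerable_eqI:
  assumes "steerable l J K" "steerable l J L"
    and "\<And>i j. i < irrep_dim J \<Longrightarrow> j < irrep_dim l \<Longrightarrow> K 0 $$ (i, j) = L 0 $$ (i, j)"
  shows "K = L"
proof -
  have "K 0 = L 0"
    using assms by (intro eq_matI) (auto simp: steerable_def dest!: spec[of _ 0])
  then show ?thesis
    using steerable_eq_value_at_0 assms(1,2) by (metis ext)
qed

section \<open>Linear combinations and a basis criterion\<close>

text \<open>This translates the abstract combinations of the module into real sums of matrix
  entries.\<close>

lemma
  fixes l J :: nat and a :: "(angle \<Rightarrow> real mat) \<Rightarrow> real"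
  assumes "finite A" "\<And>K. K \<in> A \<Longrightarrow> steerable l J K"
  shows steerable_lincomb: "steerable l J (module.lincomb (kernel_space l J) a A)"
    and index_lincomb: "i < irrep_dim J \<Longrightarrow> j < irrep_dim l \<Longrightarrow>
      module.lincomb (kernel_space l J) a A x $$ (i, j) = (\<Sum>K\<in>A. a K * K x $$ (i, j))"
proof -
  let ?V = "kernel_space l J"
  interpret vectorspace class_ring ?V
    by (rule kernel_space_vectorspace)
  \<comment> \<open>Both claims go through one induction: entries of a sum of matrices add up only
    within the dimensions, which steerability of the remaining combination supplies.\<close>
  have "steerable l J (lincomb a A) \<and> (\<forall>i < irrep_dim J. \<forall>j < irrep_dim l.
      lincomb a A x $$ (i, j) = (\<Sum>K\<in>A. a K * K x $$ (i, j)))"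
    using assms
  proof (induction A rule: finite_induct)
    case empty
    show ?case
      by (simp add: lincomb_def) (simp add: kernel_space_def steerable_zero)
  next
    case (insert K A)
    then have K: "steerable l J K" and A: "A \<subseteq> carrier ?V"
      by (auto simp: kernel_space_def)
    have "lincomb a (insert K A) = (\<lambda>x. a K \<cdot>\<^sub>m K x + lincomb a A x)"
    proof -
      have "lincomb a (insert K A) = a K \<odot>\<^bsub>?V\<^esub> K \<oplus>\<^bsub>?V\<^esub> lincomb a A"
        using insert.hyps A K lincomb_insert2[of A a K]
        by (simp add: kernel_space_def)
      then show ?thesis
        by (simp add: kernel_space_def)
    qed
    moreover have "K x \<in> carrier_mat (irrep_dim J) (irrep_dim l)"
      "lincomb a A x \<in> carrier_mat (irrep_dim J) (irrep_dim l)"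
      using K insert by (auto simp: steerable_def)
    ultimately show ?case
      using insert K by (auto simp: steerable_add steerable_smult)
  qed
  then show "steerable l J (lincomb a A)"
    and "i < irrep_dim J \<Longrightarrow> j < irrep_dim l \<Longrightarrow>
      lincomb a A x $$ (i, j) = (\<Sum>K\<in>A. a K * K x $$ (i, j))"
    by auto
qed

text \<open>Everything is tested on the values at 0. Coefficients are indexed by list positions, so
  that independence also rules out repeated entries.\<close>

lemma kernel_basisI:
  fixes Ks :: "(angle \<Rightarrow> real mat) list"
  assumes steerable: "\<And>K. K \<in> set Ks \<Longrightarrow> steerable l J K"
    and indpt: "\<And>c. (\<And>i j. i < irrep_dim J \<Longrightarrow> j < irrep_dim l \<Longrightarrow>
        (\<Sum>k<length Ks. c k * (Ks ! k) 0 $$ (i, j)) = 0) \<Longrightarrow> \<forall>k<length Ks. c k = 0"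
    and gen: "\<And>M. \<exists>c. \<forall>i < irrep_dim J. \<forall>j < irrep_dim l.
        (\<Sum>k<length Ks. c k * (Ks ! k) 0 $$ (i, j)) = M $$ (i, j)"
  shows "kernel_basis l J Ks"
proof -
  let ?V = "kernel_space l J"
  interpret vectorspace class_ring ?V
    by (rule kernel_space_vectorspace)
  have distinct: "distinct Ks"
    unfolding distinct_conv_nth
  proof (intro allI impI notI)
    fix p q
    assume pq: "p < length Ks" "q < length Ks" "p \<noteq> q" "Ks ! p = Ks ! q"
    \<comment> \<open>The difference of the unit vectors at p and q: a repeated entry would make it
      a nontrivial relation.\<close>
    define c :: "nat \<Rightarrow> real" where "c k = of_bool (k = p) - of_bool (k = q)" for k
    have "(\<Sum>k<length Ks. c k * (Ks ! k) 0 $$ (i, j)) = 0" for i j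
      using pq by (simp add: c_def left_diff_distrib sum_subtractf of_bool_def if_distrib
          [where f = "\<lambda>a. a * _"] cong: if_cong)
    then have "c p = 0"
      using indpt pq by blast
    with pq show False
      by (simp add: c_def)
  qed
  have carrier: "set Ks \<subseteq> carrier ?V"
    using steerable by (auto simp: kernel_space_def)
  \<comment> \<open>Without repetitions, sums over the set of kernels are sums over
    positions.\<close>
  have sum_nth: "(\<Sum>K\<in>set Ks. f K) = (\<Sum>k<length Ks. f (Ks ! k))"
    for f :: "(angle \<Rightarrow> real mat) \<Rightarrow> real"
    using sum.reindex_bij_betw[OF bij_betw_nth[OF distinct refl refl], of f] by simp
  have "lin_indpt (set Ks)"
  proof (rule finite_lin_indpt2)
    fix a :: "(angle \<Rightarrow> real mat) \<Rightarrow> real"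
    assume "lincomb a (set Ks) = \<zero>\<^bsub>?V\<^esub>"
    then have "lincomb a (set Ks) 0 = 0\<^sub>m (irrep_dim J) (irrep_dim l)"
      by (simp add: kernel_space_def)
    then have "(\<Sum>k<length Ks. a (Ks ! k) * (Ks ! k) 0 $$ (i, j)) = 0"
      if "i < irrep_dim J" "j < irrep_dim l" for i j
      using index_lincomb[where A = "set Ks" and x = 0, OF _ steerable that, of a] that
      by (simp add: sum_nth)
    then have "\<forall>k<length Ks. a (Ks ! k) = 0"
      using indpt[of "\<lambda>k. a (Ks ! k)"] by blast
    then show "\<forall>K\<in>set Ks. a K = \<zero>\<^bsub>class_ring\<^esub>"
      by (auto simp: in_set_conv_nth)
  qed (use carrier in auto)
  moreover have "K \<in> span (set Ks)" if "steerable l J K" for K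
  proof -
    obtain c where c: "\<And>i j. i < irrep_dim J \<Longrightarrow> j < irrep_dim l \<Longrightarrow>
        (\<Sum>k<length Ks. c k * (Ks ! k) 0 $$ (i, j)) = K 0 $$ (i, j)"
      using gen[of "K 0"] by blast
    \<comment> \<open>The coefficients move from positions to kernels through the inverse of the
      indexing, which is injective by distinctness.\<close>
    define a where "a = c \<circ> the_inv_into {..<length Ks} ((!) Ks)"
    have a: "a (Ks ! k) = c k" if "k < length Ks" for k
      using that distinct
      by (simp add: a_def the_inv_into_f_f inj_on_nth)
    \<comment> \<open>Both sides are steerable, so agreement at 0 suffices.\<close>
    have "K = lincomb a (set Ks)"
      by (rule steerable_eqI[OF that steerable_lincomb])
        (use steerable in \<open>simp_all add: index_lincomb sum_nth a c\<close>)
    then show ?thesis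
      using finite_span[of "set Ks"] carrier by auto
  qed
  then have "gen_set (set Ks)"
    using steerable_lincomb[OF finite_set steerable] finite_span[OF finite_set carrier]
    by (auto simp: kernel_space_def)
  ultimately show ?thesis
    using distinct carrier by (simp add: kernel_basis_def basis_def)
qed

section \<open>The four cases\<close>

text \<open>With 2 in successor form, an index below 2 splits into 0 and 1;
  \<open>fun_Compl_def\<close> evaluates negated functions such as \<open>- sin_k k\<close>
  pointwise.\<close>

lemmas kernel_entry_simps =
  kernel_of_def mat_of_rows_list_def irrep_def irrep_dim_def scalar_prod_def less_Suc_eq
  numeral_2_eq_2 fun_Compl_def

text \<open>Both actions are trivial, so the kernel is constant, and a 1 by 1 matrix is its entry
  times the identity.\<close>

lemma steerable_0_0:
  "steerable 0 0 K \<longleftrightarrow> (\<exists>a :: real. \<forall>x. K x = a \<cdot>\<^sub>m mat_of_rows_list 1 [[1]])"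
proof -
  have "(\<exists>M \<in> carrier_mat 1 1. \<forall>x. K x = M) \<longleftrightarrow>
      (\<exists>a :: real. \<forall>x. K x = a \<cdot>\<^sub>m mat_of_rows_list 1 [[1]])"
  proof
    assume "\<exists>M \<in> carrier_mat 1 1. \<forall>x. K x = M"
    then obtain M where "M \<in> carrier_mat 1 1" "\<And>x. K x = M"
      by blast
    then have "K x = M $$ (0, 0) \<cdot>\<^sub>m mat_of_rows_list 1 [[1]]" for x
      by (intro eq_matI) (auto simp: mat_of_rows_list_def)
    then show "\<exists>a :: real. \<forall>x. K x = a \<cdot>\<^sub>m mat_of_rows_list 1 [[1]]"
      by blast
  qed (auto simp: mat_of_rows_list_def)
  moreover have "irrep 0 x * M * irrep 0 y = M" if "M \<in> carrier_mat 1 1" for x y M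
    using that by (simp add: irrep_def)
  ultimately show ?thesis
    by (auto simp: steerable_iff_value_at_0 irrep_dim_def)
qed

text \<open>The kernels are the two columns of \<open>irrep J x\<close>; at 0 they are the standard
  basis vectors.\<close>

lemma kernel_basis_0_pos:
  assumes "J > 0"
  shows "kernel_basis 0 J
    [kernel_of (mat_of_rows_list 1 [[cos_k (int J)], [sin_k (int J)]]),
     kernel_of (mat_of_rows_list 1 [[- sin_k (int J)], [cos_k (int J)]])]"
proof (rule kernel_basisI, goal_cases)
  case (1 K)
  then show ?case
    using assms
    by (auto intro!: steerable_kernel_of eq_matI simp: kernel_entry_simps)
next
  case (2 c)
  from 2[of 0 0] 2[of 1 0] show ?case
    using assms by (auto simp: kernel_entry_simps)
next
  case (3 M)
  show ?case
    using assms
    by (intro exI[of _ "(!) [M $$ (0, 0), M $$ (1, 0)]"]) (auto simp: kernel_entry_simps)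
qed

text \<open>The kernels are the first row of \<open>irrep l (- x)\<close> and the negative of its
  second row.\<close>

lemma kernel_basis_pos_0:
  assumes "l > 0"
  shows "kernel_basis l 0
    [kernel_of (mat_of_rows_list 2 [[cos_k (int l), sin_k (int l)]]),
     kernel_of (mat_of_rows_list 2 [[sin_k (int l), - cos_k (int l)]])]"
proof (rule kernel_basisI, goal_cases)
  case (1 K)
  then show ?case
    using assms
    by (auto intro!: steerable_kernel_of eq_matI simp: kernel_entry_simps)
next
  case (2 c)
  from 2[of 0 0] 2[of 0 1] show ?case
    using assms by (auto simp: kernel_entry_simps)
next
  case (3 M)
  \<comment> \<open>The second kernel has value (0, -1) at 0, hence the sign of the second
    coefficient.\<close>
  show ?case
    using assms
    by (intro exI[of _ "(!) [M $$ (0, 0), - M $$ (0, 1)]"]) (auto simp: kernel_entry_simps)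
qed

text \<open>At 0 the kernels are the identity, the quarter turn and two reflections. The first two
  commute with rotations, so the angles J x and - l x add to (J - l) x; moving a rotation past a
  reflection inverts it, which gives (J + l) x.\<close>

lemma kernel_basis_pos_pos:
  assumes "l > 0" "J > 0"
  shows "kernel_basis l J
    [kernel_of (mat_of_rows_list 2
       [[cos_k (int J - int l), - sin_k (int J - int l)],
        [sin_k (int J - int l), cos_k (int J - int l)]]),
     kernel_of (mat_of_rows_list 2
       [[- sin_k (int J - int l), - cos_k (int J - int l)],
        [cos_k (int J - int l), - sin_k (int J - int l)]]),
     kernel_of (mat_of_rows_list 2
       [[cos_k (int J + int l), sin_k (int J + int l)],
        [sin_k (int J + int l), - cos_k (int J + int l)]]),
     kernel_of (mat_of_rows_list 2
       [[- sin_k (int J + int l), cos_k (int J + int l)],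
        [cos_k (int J + int l), sin_k (int J + int l)]])]"
proof (rule kernel_basisI, goal_cases)
  case (1 K)
  then show ?case
    using assms
    by (auto intro!: steerable_kernel_of eq_matI simp: kernel_entry_simps
        cos_k_add_index sin_k_add_index cos_k_diff_index sin_k_diff_index algebra_simps)
next
  case (2 c)
  from 2[of 0 0] 2[of 0 1] 2[of 1 0] 2[of 1 1] show ?case
    using assms by (auto simp: kernel_entry_simps)
next
  case (3 M)
  \<comment> \<open>The diagonal entries of M are the sum and the difference of the coefficients 0
    and 2; the entries (1, 0) and (0, 1) are the sum and the difference of the coefficients 3 and 1.
    Solving gives the halves.\<close>
  show ?case
    using assms
    by (intro exI[of _ "(!) [(M $$ (0, 0) + M $$ (1, 1)) / 2, (M $$ (1, 0) - M $$ (0, 1)) / 2,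
        (M $$ (0, 0) - M $$ (1, 1)) / 2, (M $$ (0, 1) + M $$ (1, 0)) / 2]"])
      (auto simp: kernel_entry_simps field_simps)
qed

theorem propositionE6:
  fixes l J :: nat
  shows
    "(l = 0 \<and> J = 0 \<longrightarrow>
        (\<forall>K. steerable l J K \<longleftrightarrow>
          (\<exists>a :: real. \<forall>x. K x = a \<cdot>\<^sub>m mat_of_rows_list 1 [[1]]))) \<and>
     (l = 0 \<and> J > 0 \<longrightarrow>
        kernel_basis l J
          [kernel_of (mat_of_rows_list 1
             [[cos_k (int J)],
              [sin_k (int J)]]),
           kernel_of (mat_of_rows_list 1
             [[- sin_k (int J)],
              [cos_k (int J)]])]) \<and>
     (l > 0 \<and> J = 0 \<longrightarrow>
        kernel_basis l J
          [kernel_of (mat_of_rows_list 2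
             [[cos_k (int l), sin_k (int l)]]),
           kernel_of (mat_of_rows_list 2
             [[sin_k (int l), - cos_k (int l)]])]) \<and>
     (l > 0 \<and> J > 0 \<longrightarrow>
        kernel_basis l J
          [kernel_of (mat_of_rows_list 2
             [[cos_k (int J - int l), - sin_k (int J - int l)],
              [sin_k (int J - int l), cos_k (int J - int l)]]),
           kernel_of (mat_of_rows_list 2
             [[- sin_k (int J - int l), - cos_k (int J - int l)],
              [cos_k (int J - int l), - sin_k (int J - int l)]]),
           kernel_of (mat_of_rows_list 2
             [[cos_k (int J + int l), sin_k (int J + int l)],
              [sin_k (int J + int l), - cos_k (int J + int l)]]),
           kernel_of (mat_of_rows_list 2
             [[- sin_k (int J + int l), cos_k (int J + int l)],
              [cos_k (int J + int l), sin_k (int J + int l)]])])"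
proof (intro conjI impI)
  assume "l = 0 \<and> J = 0"
  then show "\<forall>K. steerable l J K \<longleftrightarrow> (\<exists>a :: real. \<forall>x. K x = a \<cdot>\<^sub>m mat_of_rows_list 1 [[1]])"
    by (auto simp: steerable_0_0)
next
  assume "l = 0 \<and> J > 0"
  then show "kernel_basis l J
          [kernel_of (mat_of_rows_list 1
             [[cos_k (int J)],
              [sin_k (int J)]]),
           kernel_of (mat_of_rows_list 1
             [[- sin_k (int J)],
              [cos_k (int J)]])]"
    using kernel_basis_0_pos by simp
next
  assume "l > 0 \<and> J = 0"
  then show "kernel_basis l J
          [kernel_of (mat_of_rows_list 2
             [[cos_k (int l), sin_k (int l)]]),
           kernel_of (mat_of_rows_list 2
             [[sin_k (int l), - cos_k (int l)]])]"
    using kernel_basis_pos_0 by simp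
next
  assume "l > 0 \<and> J > 0"
  then show "kernel_basis l J
          [kernel_of (mat_of_rows_list 2
             [[cos_k (int J - int l), - sin_k (int J - int l)],
              [sin_k (int J - int l), cos_k (int J - int l)]]),
           kernel_of (mat_of_rows_list 2
             [[- sin_k (int J - int l), - cos_k (int J - int l)],
              [cos_k (int J - int l), - sin_k (int J - int l)]]),
           kernel_of (mat_of_rows_list 2
             [[cos_k (int J + int l), sin_k (int J + int l)],
              [sin_k (int J + int l), - cos_k (int J + int l)]]),
           kernel_of (mat_of_rows_list 2
             [[- sin_k (int J + int l), cos_k (int J + int l)],
              [cos_k (int J + int l), sin_k (int J + int l)]])]"
    using kernel_basis_pos_pos by simp
qed

end
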